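(* Let $G$ be a finitely generated group in which every infinite normal subgroup has trivial centralizer. Then every infinite commensurated relatively residually finite subgroup $H$ of $G$ has trivial FC-centralizer, i.e. $\mathrm{FC}_G(H) = \{1\}$.
   Context: A subgroup $H$ of a group $G$ is commensurated if $[H : H \cap gHg^{-1}] < \infty$ for all $g \in G$. Let $\mathcal{N}(G,H)$ be the set of normal subgroups of $G$ that contain a finite index subgroup of $H$. The subgroup $H$ is relatively residually finite in $G$ if $\bigcap_{M \in \mathcal{N}(G,H)} M = \{1\}$. The FC-centralizer $\mathrm{FC}_G(H)$ is the set of elements $g \in G$ that centralize some finite index subgroup of $H$. *)

theory Defs
  imports "HOL-Algebra.Algebra"
begin

definition finitely_generated :: "('a, 'b) monoid_scheme \<Rightarrow> bool" where
  "finitely_generated G \<longleftrightarrow> (\<exists>S. finite S \<and> S \<subseteq> carrier G \<and> generate G S = carrier G)"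

definition centralizer :: "('a, 'b) monoid_scheme \<Rightarrow> 'a set \<Rightarrow> 'a set" where
  "centralizer G A = {g \<in> carrier G. \<forall>a\<in>A. g \<otimes>\<^bsub>G\<^esub> a = a \<otimes>\<^bsub>G\<^esub> g}"

(* The cosets are those of K in H, not in G; the index is compared as the finiteness of the
   coset space because card would send an infinite one to 0. *)
definition finite_index_subgroup :: "('a, 'b) monoid_scheme \<Rightarrow> 'a set \<Rightarrow> 'a set \<Rightarrow> bool" where
  "finite_index_subgroup G K H \<longleftrightarrow>
     subgroup K (G\<lparr>carrier := H\<rparr>) \<and> finite (rcosets\<^bsub>G\<lparr>carrier := H\<rparr>\<^esub> K)"

definition commensurated :: "('a, 'b) monoid_scheme \<Rightarrow> 'a set \<Rightarrow> bool" where
  "commensurated G H \<longleftrightarrow>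
     (\<forall>g\<in>carrier G. finite_index_subgroup G (H \<inter> (g <#\<^bsub>G\<^esub> H #>\<^bsub>G\<^esub> inv\<^bsub>G\<^esub> g)) H)"

definition virtual_normal_overgroups :: "('a, 'b) monoid_scheme \<Rightarrow> 'a set \<Rightarrow> 'a set set" where
  "virtual_normal_overgroups G H = {M. M \<lhd> G \<and> (\<exists>K. finite_index_subgroup G K H \<and> K \<subseteq> M)}"

definition relatively_residually_finite :: "('a, 'b) monoid_scheme \<Rightarrow> 'a set \<Rightarrow> bool" where
  "relatively_residually_finite G H \<longleftrightarrow> \<Inter> (virtual_normal_overgroups G H) = {\<one>\<^bsub>G\<^esub>}"

definition FC_centralizer :: "('a, 'b) monoid_scheme \<Rightarrow> 'a set \<Rightarrow> 'a set" where
  "FC_centralizer G H =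
     {g \<in> carrier G. \<exists>K. finite_index_subgroup G K H \<and> g \<in> centralizer G K}"

end

theory Submission
  imports Defs
begin

text \<open>Let \<open>f\<close> centralize a finite index subgroup \<open>K\<close> of \<open>H\<close>, and let \<open>C\<close> be the closure of \<open>K\<close> in the
  topology whose neighbourhoods of the identity are the members of \<open>\<N>(G,H)\<close>. This topology is
  Hausdorff, so \<open>f\<close> centralizes \<open>C\<close>. For a generator \<open>s\<close>, the group \<open>s K s\<^sup>-\<^sup>1\<close> is covered by finitely
  many cosets \<open>K x\<close>, and the finitely many \<open>x \<notin> C\<close> can all be separated from \<open>K\<close> by a single
  \<open>M \<in> \<N>(G,H)\<close>. Then \<open>s (M \<inter> C) s\<^sup>-\<^sup>1 \<subseteq> C\<close> for every generator, so \<open>M \<inter> C\<close> is an infinite normal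
  subgroup of \<open>G\<close> that is centralized by \<open>f\<close>, and \<open>f = 1\<close>.\<close>

text \<open>A point \<open>x\<close> is in the closure iff every neighbourhood \<open>M x\<close>
  meets \<open>K\<close>; since \<open>M\<close> is a subgroup, this says that \<open>x\<close> lies
  in the product \<open>M K\<close>.\<close>

definition virtual_closure :: "('a, 'b) monoid_scheme \<Rightarrow> 'a set \<Rightarrow> 'a set \<Rightarrow> 'a set" where
  "virtual_closure G H K =
     {x \<in> carrier G. \<forall>M\<in>virtual_normal_overgroups G H. x \<in> M <#>\<^bsub>G\<^esub> K}"

context group
begin

section \<open>Cosets and finite index subgroups\<close>

lemma inv_mult_cancel [simp]:
  assumes "x \<in> carrier G" "y \<in> carrier G"
  shows "inv x \<otimes> (x \<otimes> y) = y" "x \<otimes> (inv x \<otimes> y) = y"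
  using assms m_assoc[of "inv x" x y] m_assoc[of x "inv x" y] by simp_all

text \<open>Right translation is injective, so a coset of \<open>A \<inter> B\<close> is a coset of
  \<open>A\<close> intersected with a coset of \<open>B\<close>, and there are only finitely many
  such pairs.\<close>

lemma finite_rcosets_Int:
  assumes "subgroup A G" "subgroup B G" "finite (rcosets A)" "finite (rcosets B)"
  shows "finite (rcosets (A \<inter> B))"
proof -
  have "(A \<inter> B) #> g = (A #> g) \<inter> (B #> g)" if g: "g \<in> carrier G" for g
  proof -
    have "inj_on (\<lambda>a. a \<otimes> g) (carrier G)"
      using g by (simp add: inj_on_def)
    then have "(\<lambda>a. a \<otimes> g) ` (A \<inter> B) = (\<lambda>a. a \<otimes> g) ` A \<inter> (\<lambda>a. a \<otimes> g) ` B"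
      using inj_on_image_Int subgroup.subset assms(1,2) by metis
    then show ?thesis
      by (simp add: r_coset_def image_def) blast
  qed
  then have "rcosets (A \<inter> B) \<subseteq> (\<lambda>(U, V). U \<inter> V) ` ((rcosets A) \<times> (rcosets B))"
    by (fastforce simp: RCOSETS_def)
  then show ?thesis
    using assms(3,4) finite_subset by blast
qed

lemma finite_index_refl:
  assumes "subgroup H G"
  shows "finite_index_subgroup G H H"
proof -
  interpret H: group "G\<lparr>carrier := H\<rparr>"
    using assms subgroup_imp_group by blast
  have "subgroup H (G\<lparr>carrier := H\<rparr>)"
    using H.subgroup_self by simp
  moreover have "rcosets\<^bsub>G\<lparr>carrier := H\<rparr>\<^esub> H \<subseteq> {H}"
    using H.coset_join2[OF _ H.subgroup_self] by (auto simp: RCOSETS_def)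
  ultimately show ?thesis
    unfolding finite_index_subgroup_def using finite_subset by blast
qed

lemma finite_index_Int:
  assumes "subgroup H G" "finite_index_subgroup G A H" "finite_index_subgroup G B H"
  shows "finite_index_subgroup G (A \<inter> B) H"
proof -
  interpret H: group "G\<lparr>carrier := H\<rparr>"
    using assms(1) subgroup_imp_group by blast
  show ?thesis
    using assms(2,3) H.finite_rcosets_Int H.subgroups_Inter_pair
    unfolding finite_index_subgroup_def by blast
qed

lemma finite_index_subgroupD:
  assumes "subgroup H G" "finite_index_subgroup G K H"
  shows "subgroup K G" "K \<subseteq> H"
proof -
  have K: "subgroup K (G\<lparr>carrier := H\<rparr>)"
    using assms(2) by (simp add: finite_index_subgroup_def)
  show "K \<subseteq> H"
    using subgroup.subset[OF K] by simp
  show "subgroup K G"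
    using incl_subgroup[OF assms(1) K] .
qed

text \<open>The form in which finite index is used later: \<open>R\<close> picks one representative
  for each coset of \<open>K\<close> in \<open>H\<close>.\<close>

lemma finite_index_cover:
  assumes "subgroup H G" "finite_index_subgroup G K H"
  obtains R where "finite R" "R \<subseteq> H" "H \<subseteq> K <#> R"
proof -
  have fin: "finite ((\<lambda>h. K #> h) ` H)"
  proof (rule finite_subset)
    show "(\<lambda>h. K #> h) ` H \<subseteq> rcosets\<^bsub>G\<lparr>carrier := H\<rparr>\<^esub> K"
      by (auto simp: RCOSETS_def r_coset_def)
    show "finite (rcosets\<^bsub>G\<lparr>carrier := H\<rparr>\<^esub> K)"
      using assms(2) by (simp add: finite_index_subgroup_def)
  qed
  obtain R where R: "R \<subseteq> H" "finite R" "(\<lambda>h. K #> h) ` H = (\<lambda>h. K #> h) ` R"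
    using finite_subset_image[OF fin order_refl] by metis
  have "H \<subseteq> K <#> R"
  proof
    fix h assume h: "h \<in> H"
    then obtain x where x: "x \<in> R" "K #> h = K #> x"
      using R(3) by blast
    have "h \<in> K #> x"
      unfolding x(2)[symmetric]
      using rcos_self finite_index_subgroupD(1)[OF assms] subgroup.mem_carrier[OF assms(1) h] by blast
    then show "h \<in> K <#> R"
      using x(1) by (auto simp: r_coset_def set_mult_def)
  qed
  then show thesis
    using that R(1,2) by blast
qed

lemma finite_index_infinite:
  assumes "subgroup H G" "finite_index_subgroup G K H" "infinite H"
  shows "infinite K"
proof
  assume "finite K"
  obtain R where "finite R" "H \<subseteq> K <#> R"
    using finite_index_cover[OF assms(1,2)] by metis
  moreover have "K <#> R = (\<lambda>(k, x). k \<otimes> x) ` (K \<times> R)"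
    by (auto simp: set_mult_def)
  ultimately have "finite H"
    using \<open>finite K\<close> finite_subset by fastforce
  then show False
    using assms(3) by simp
qed

section \<open>The base of neighbourhoods of the identity\<close>

lemma virtual_normal_overgroups_Int:
  assumes "subgroup H G" "M \<in> virtual_normal_overgroups G H" "N \<in> virtual_normal_overgroups G H"
  shows "M \<inter> N \<in> virtual_normal_overgroups G H"
proof -
  obtain A B where "M \<lhd> G" "finite_index_subgroup G A H" "A \<subseteq> M"
      "N \<lhd> G" "finite_index_subgroup G B H" "B \<subseteq> N"
    using assms(2,3) unfolding virtual_normal_overgroups_def by blast
  then have "M \<inter> N \<lhd> G" "finite_index_subgroup G (A \<inter> B) H" "A \<inter> B \<subseteq> M \<inter> N"
    using normal_subgroup_intersect finite_index_Int[OF assms(1)] by blast+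
  then show ?thesis
    unfolding virtual_normal_overgroups_def by blast
qed

lemma carrier_virtual_normal_overgroup:
  assumes "subgroup H G"
  shows "carrier G \<in> virtual_normal_overgroups G H"
proof -
  have "carrier G \<lhd> G"
    using normal_inv_iff subgroup_self by simp
  then show ?thesis
    unfolding virtual_normal_overgroups_def
    using finite_index_refl[OF assms] subgroup.subset[OF assms] by blast
qed

lemma virtual_normal_overgroup_below:
  assumes "subgroup H G" "finite I" "\<And>i. i \<in> I \<Longrightarrow> N i \<in> virtual_normal_overgroups G H"
  obtains M where "M \<in> virtual_normal_overgroups G H" "\<And>i. i \<in> I \<Longrightarrow> M \<subseteq> N i"
proof -
  have "\<exists>M\<in>virtual_normal_overgroups G H. \<forall>i\<in>I. M \<subseteq> N i"
    using assms(2,3)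
  proof (induction I rule: finite_induct)
    case empty
    then show ?case
      using carrier_virtual_normal_overgroup[OF assms(1)] by blast
  next
    case (insert i I)
    then obtain M where "M \<in> virtual_normal_overgroups G H" "\<forall>i\<in>I. M \<subseteq> N i"
      by auto
    then show ?case
      using virtual_normal_overgroups_Int[OF assms(1), of M "N i"] insert.prems by blast
  qed
  then show thesis
    using that by blast
qed

section \<open>The closure of a subgroup\<close>

lemma subgroup_virtual_closure:
  assumes "subgroup K G"
  shows "subgroup (virtual_closure G H K) G"
proof -
  have *: "subgroup (M <#> K) G" if "M \<in> virtual_normal_overgroups G H" for M
    using that assms mult_norm_subgroup by (simp add: virtual_normal_overgroups_def)
  \<comment> \<open>Each \<open>M <#> K\<close> is a subgroup because \<open>M\<close> is normal.
    Inserting \<open>carrier G\<close> accounts for the condition \<open>x \<in> carrier G\<close>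
    and makes the family visibly nonempty.\<close>
  have "virtual_closure G H K = \<Inter> (insert (carrier G) ((\<lambda>M. M <#> K) ` virtual_normal_overgroups G H))"
    by (auto simp: virtual_closure_def)
  also have "subgroup \<dots> G"
    by (rule subgroups_Inter) (use * subgroup_self in auto)
  finally show ?thesis .
qed

lemma subset_virtual_closure:
  assumes "subgroup K G"
  shows "K \<subseteq> virtual_closure G H K"
proof
  fix k assume k: "k \<in> K"
  have "k \<in> M <#> K" if "M \<in> virtual_normal_overgroups G H" for M
  proof -
    have "\<one> \<in> M"
      using that by (simp add: virtual_normal_overgroups_def normal_imp_subgroup subgroup.one_closed)
    moreover have "k = \<one> \<otimes> k"
      using k subgroup.mem_carrier[OF assms] by simp
    ultimately show ?thesis
      using k unfolding set_mult_def by blast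
  qed
  then show "k \<in> virtual_closure G H K"
    using k subgroup.mem_carrier[OF assms] by (simp add: virtual_closure_def)
qed

text \<open>Write \<open>y = m k\<close> with \<open>m \<in> M\<close> and \<open>k \<in> K\<close>.
  As \<open>f\<close> commutes with \<open>k\<close>, the commutator of \<open>f\<close> and
  \<open>y\<close> equals \<open>(f m f^-1) m^-1\<close>, which is in \<open>M\<close>. This holds
  for every \<open>M\<close>, and the intersection of all \<open>M\<close> is trivial.\<close>

lemma centralizes_virtual_closure:
  assumes "relatively_residually_finite G H" "subgroup K G" "f \<in> centralizer G K"
  shows "f \<in> centralizer G (virtual_closure G H K)"
proof -
  have f: "f \<in> carrier G"
    using assms(3) by (simp add: centralizer_def)
  have "f \<otimes> y = y \<otimes> f" if y: "y \<in> virtual_closure G H K" for y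
  proof -
    have yc: "y \<in> carrier G"
      using y by (simp add: virtual_closure_def)
    have "f \<otimes> y \<otimes> inv f \<otimes> inv y \<in> M" if M: "M \<in> virtual_normal_overgroups G H" for M
    proof -
      interpret M: normal M G
        using M by (simp add: virtual_normal_overgroups_def)
      obtain m k where mk: "m \<in> M" "k \<in> K" "y = m \<otimes> k"
        using y M by (auto simp: virtual_closure_def set_mult_def)
      have kc: "k \<in> carrier G" and fk: "f \<otimes> k = k \<otimes> f"
        using mk(2) assms(2,3) by (auto simp: centralizer_def subgroup.mem_carrier)
      have mc: "m \<in> carrier G"
        using mk(1) by simp
      have "f \<otimes> y \<otimes> inv f \<otimes> inv y = f \<otimes> m \<otimes> (k \<otimes> inv f \<otimes> inv k) \<otimes> inv m"
        unfolding mk(3) using f kc mc by (simp add: m_assoc inv_mult_group)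
      also have "k \<otimes> inv f \<otimes> inv k = inv f"
        using f kc fk by (metis inv_closed inv_mult_cancel(2) inv_mult_group m_assoc)
      finally have "f \<otimes> y \<otimes> inv f \<otimes> inv y = (f \<otimes> m \<otimes> inv f) \<otimes> inv m" .
      then show ?thesis
        using M.inv_op_closed2[OF f mk(1)] mk(1) by simp
    qed
    then have "f \<otimes> y \<otimes> inv f \<otimes> inv y = \<one>"
      using assms(1) unfolding relatively_residually_finite_def by blast
    then have "f \<otimes> y \<otimes> inv (y \<otimes> f) \<otimes> (y \<otimes> f) = \<one> \<otimes> (y \<otimes> f)"
      using f yc by (simp add: m_assoc inv_mult_group)
    then show ?thesis
      using f yc by (simp add: m_assoc del: inv_mult_cancel)
  qed
  then show ?thesis
    using f by (simp add: centralizer_def)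
qed

section \<open>Conjugation by generators\<close>

text \<open>Finitely many cosets \<open>?J y\<close> cover \<open>K\<close>, conjugation by
  \<open>s\<close> sends \<open>?J\<close> into \<open>H\<close>, and finitely many cosets
  \<open>K z\<close> cover \<open>H\<close>. The representatives are therefore the products
  \<open>z (s y s^-1)\<close>.\<close>

lemma conjugate_cover:
  assumes "subgroup H G" "commensurated G H" "finite_index_subgroup G K H" "s \<in> carrier G"
  obtains R where "finite R" "R \<subseteq> carrier G" "\<And>k. k \<in> K \<Longrightarrow> s \<otimes> k \<otimes> inv s \<in> K <#> R"
proof -
  have K: "subgroup K G" "K \<subseteq> H"
    using finite_index_subgroupD[OF assms(1,3)] by auto
  have H: "H \<subseteq> carrier G"
    using assms(1) subgroup.subset by blast
  \<comment> \<open>Commensuration is applied to \<open>inv s\<close>, so that elements of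
    \<open>?J\<close> have the form \<open>s^-1 h s\<close> with \<open>h \<in> H\<close>.\<close>
  let ?J = "H \<inter> (inv s <# H #> s)"
  have "finite_index_subgroup G ?J H"
    using assms(2,4) unfolding commensurated_def by (metis inv_closed inv_inv)
  then obtain Y where Y: "finite Y" "Y \<subseteq> H" "H \<subseteq> ?J <#> Y"
    using finite_index_cover[OF assms(1)] by metis
  obtain Z where Z: "finite Z" "Z \<subseteq> H" "H \<subseteq> K <#> Z"
    using finite_index_cover[OF assms(1,3)] by metis
  let ?R = "(\<lambda>(z, y). z \<otimes> (s \<otimes> y \<otimes> inv s)) ` (Z \<times> Y)"
  show thesis
  proof
    show "finite ?R"
      using Y Z by simp
    show "?R \<subseteq> carrier G"
      using Y(2) Z(2) H assms(4) by (auto intro!: m_closed simp: subset_iff)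
    fix k assume "k \<in> K"
    then obtain h y where hy: "h \<in> H" "y \<in> Y" "k = inv s \<otimes> h \<otimes> s \<otimes> y"
      using K(2) Y(3) by (fastforce simp: set_mult_def l_coset_def r_coset_def)
    obtain k' z where kz: "k' \<in> K" "z \<in> Z" "h = k' \<otimes> z"
      using hy(1) Z(3) by (auto simp: set_mult_def)
    have c: "h \<in> carrier G" "y \<in> carrier G" "k' \<in> carrier G" "z \<in> carrier G"
      using hy kz H Y Z K by auto
    have "s \<otimes> k \<otimes> inv s = s \<otimes> inv s \<otimes> h \<otimes> (s \<otimes> y \<otimes> inv s)"
      unfolding hy(3) using c assms(4) by (simp add: m_assoc)
    also have "\<dots> = k' \<otimes> (z \<otimes> (s \<otimes> y \<otimes> inv s))"
      unfolding kz(3) using c assms(4) by (simp add: m_assoc)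
    finally show "s \<otimes> k \<otimes> inv s \<in> K <#> ?R"
      using kz hy by (auto simp: set_mult_def)
  qed
qed

text \<open>The elements \<open>g\<close> with \<open>g L g^-1 \<subseteq> L\<close> are closed
  under products, but such an inclusion may be strict; hence inverses of generators are tested as
  well.\<close>

lemma normal_if_generators_normalize:
  assumes "subgroup L G" "S \<subseteq> carrier G" "generate G S = carrier G"
    and "\<And>s l. s \<in> S \<union> m_inv G ` S \<Longrightarrow> l \<in> L \<Longrightarrow> s \<otimes> l \<otimes> inv s \<in> L"
  shows "L \<lhd> G"
proof -
  have "\<forall>l\<in>L. g \<otimes> l \<otimes> inv g \<in> L" if "g \<in> generate G S" for g
    using that
  proof induction
    case one
    then show ?case
      using subgroup.mem_carrier[OF assms(1)] by simp
  next
    case (incl h)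
    then show ?case
      using assms(4) by blast
  next
    case (inv h)
    then show ?case
      using assms(4)[of "inv h"] by blast
  next
    case (eng g h)
    show ?case
    proof
      fix l assume l: "l \<in> L"
      have c: "g \<in> carrier G" "h \<in> carrier G" "l \<in> carrier G"
        using eng l assms(3) subgroup.mem_carrier[OF assms(1)] by auto
      have "g \<otimes> (h \<otimes> l \<otimes> inv h) \<otimes> inv g \<in> L"
        using eng l by blast
      then show "g \<otimes> h \<otimes> l \<otimes> inv (g \<otimes> h) \<in> L"
        using c by (simp add: m_assoc inv_mult_group)
    qed
  qed
  then show ?thesis
    using assms(1,3) normal_inv_iff by blast
qed

text \<open>\<open>M\<close> separates from \<open>K\<close> those coset representatives in \<open>R\<close> that lie outside the closure.\<close>

lemma conjugate_in_virtual_closure: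
  assumes H: "subgroup H G" and K: "subgroup K G" and s: "s \<in> carrier G"
    and M: "M \<in> virtual_normal_overgroups G H"
    and R: "R \<subseteq> carrier G" "\<And>k. k \<in> K \<Longrightarrow> s \<otimes> k \<otimes> inv s \<in> K <#> R"
    and sep: "\<And>x. x \<in> R \<Longrightarrow> x \<in> M <#> K \<Longrightarrow> x \<in> virtual_closure G H K"
    and l: "l \<in> M" "l \<in> virtual_closure G H K"
  shows "s \<otimes> l \<otimes> inv s \<in> virtual_closure G H K"
proof -
  interpret M: normal M G
    using M by (simp add: virtual_normal_overgroups_def)
  let ?y = "s \<otimes> l \<otimes> inv s"
  have lc: "l \<in> carrier G" and yc: "?y \<in> carrier G" and yM: "?y \<in> M"
    using l s M.inv_op_closed2 by auto
  have "?y \<in> N <#> K" if N: "N \<in> virtual_normal_overgroups G H" for N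
  proof -
    interpret N: normal N G
      using N by (simp add: virtual_normal_overgroups_def)
    have NK: "subgroup (N <#> K) G"
      using mult_norm_subgroup[OF N.normal_axioms K] .
    \<comment> \<open>Testing the closure at \<open>M \<inter> N\<close> puts \<open>m\<close> in
      both groups: \<open>M\<close> is where representatives are separated, \<open>N\<close> is
      where the conclusion is wanted.\<close>
    have "l \<in> (M \<inter> N) <#> K"
      using l(2) virtual_normal_overgroups_Int[OF H M N] by (auto simp: virtual_closure_def)
    then obtain m k where mk: "m \<in> M" "m \<in> N" "k \<in> K" "l = m \<otimes> k"
      by (auto simp: set_mult_def)
    obtain k' x where kx: "k' \<in> K" "x \<in> R" "s \<otimes> k \<otimes> inv s = k' \<otimes> x"
      using R(2)[OF mk(3)] by (auto simp: set_mult_def)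
    define n where "n = s \<otimes> m \<otimes> inv s"
    have n: "n \<in> M" "n \<in> N"
      unfolding n_def using mk s M.inv_op_closed2 N.inv_op_closed2 by auto
    have c: "m \<in> carrier G" "k \<in> carrier G" "k' \<in> carrier G" "x \<in> carrier G" "n \<in> carrier G"
      using mk kx R(1) subgroup.mem_carrier[OF K] n by auto
    have "?y = n \<otimes> (s \<otimes> k \<otimes> inv s)"
      unfolding n_def mk(4) using c s by (simp add: m_assoc)
    then have y: "?y = n \<otimes> k' \<otimes> x"
      using c kx(3) by (simp add: m_assoc)
    then have "x = inv (n \<otimes> k') \<otimes> ?y"
      using c yc by (metis inv_mult_cancel(1) m_closed)
    \<comment> \<open>Here \<open>n\<close> and \<open>?y\<close> both lie in \<open>M\<close>, so
      this displays \<open>x\<close> as a conjugate of an element of \<open>M\<close> followed by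
      \<open>inv k'\<close>.\<close>
    then have x: "x = (inv k' \<otimes> (inv n \<otimes> ?y) \<otimes> inv (inv k')) \<otimes> inv k'"
      using c yc by (simp add: m_assoc inv_mult_group del: inv_inv)
    have "inv k' \<otimes> (inv n \<otimes> ?y) \<otimes> inv (inv k') \<in> M"
      using M.inv_op_closed2[of "inv k'" "inv n \<otimes> ?y"] n yM c by blast
    then have "x \<in> M <#> K"
      by (subst x) (use kx(1) subgroup.m_inv_closed[OF K] in \<open>simp only: set_mult_def, blast\<close>)
    \<comment> \<open>Separation turns membership in the single product \<open>M <#> K\<close> into
      membership in the closure, hence in \<open>N <#> K\<close> for the arbitrary
      \<open>N\<close>.\<close>
    then have "x \<in> N <#> K"
      using sep kx(2) N by (auto simp: virtual_closure_def)
    moreover have "n \<otimes> k' \<in> N <#> K"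
      using n kx(1) by (auto simp: set_mult_def)
    ultimately show ?thesis
      using y subgroup.m_closed[OF NK] by metis
  qed
  then show ?thesis
    using yc by (simp add: virtual_closure_def)
qed

section \<open>The infinite normal subgroup\<close>

lemma infinite_normal_in_virtual_closure:
  assumes fg: "finitely_generated G" and H: "subgroup H G" "infinite H"
    and comm: "commensurated G H" and K: "finite_index_subgroup G K H"
  obtains L where "L \<lhd> G" "infinite L" "L \<subseteq> virtual_closure G H K"
proof -
  let ?C = "virtual_closure G H K" and ?\<N> = "virtual_normal_overgroups G H"
  have sK: "subgroup K G"
    using finite_index_subgroupD[OF H(1) K] by simp
  obtain S where S: "finite S" "S \<subseteq> carrier G" "generate G S = carrier G"
    using fg unfolding finitely_generated_def by blast
  let ?T = "S \<union> m_inv G ` S"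
  have T: "finite ?T" "?T \<subseteq> carrier G"
    using S by auto
  have "\<forall>s\<in>?T. \<exists>R. finite R \<and> R \<subseteq> carrier G \<and> (\<forall>k\<in>K. s \<otimes> k \<otimes> inv s \<in> K <#> R)"
  proof
    fix s assume "s \<in> ?T"
    then have "s \<in> carrier G"
      using T(2) by (rule rev_subsetD)
    then obtain R where "finite R" "R \<subseteq> carrier G" "\<And>k. k \<in> K \<Longrightarrow> s \<otimes> k \<otimes> inv s \<in> K <#> R"
      using conjugate_cover[OF H(1) comm K, of s] by blast
    then show "\<exists>R. finite R \<and> R \<subseteq> carrier G \<and> (\<forall>k\<in>K. s \<otimes> k \<otimes> inv s \<in> K <#> R)"
      by blast
  qed
  then obtain R where R: "\<And>s. s \<in> ?T \<Longrightarrow> finite (R s)" "\<And>s. s \<in> ?T \<Longrightarrow> R s \<subseteq> carrier G"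
      "\<And>s k. s \<in> ?T \<Longrightarrow> k \<in> K \<Longrightarrow> s \<otimes> k \<otimes> inv s \<in> K <#> R s"
    by metis
  \<comment> \<open>The representatives to be separated from \<open>K\<close>. There are finitely
    many because \<open>?T\<close> is finite, which is where finite generation enters.\<close>
  let ?I = "(\<Union>s\<in>?T. R s) - ?C"
  have I: "finite ?I"
    using T(1) R(1) by (intro finite_Diff finite_UN_I) auto
  have "\<forall>x\<in>?I. \<exists>N\<in>?\<N>. x \<notin> N <#> K"
    using R(2) unfolding virtual_closure_def by blast
  then obtain N where N: "\<And>x. x \<in> ?I \<Longrightarrow> N x \<in> ?\<N>" "\<And>x. x \<in> ?I \<Longrightarrow> x \<notin> N x <#> K"
    by metis
  obtain M where M: "M \<in> ?\<N>" "\<And>x. x \<in> ?I \<Longrightarrow> M \<subseteq> N x"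
    using virtual_normal_overgroup_below[of H ?I N, OF H(1) I N(1)] by blast
  have sep: "x \<in> ?C" if "s \<in> ?T" "x \<in> R s" "x \<in> M <#> K" for s x
  proof (rule ccontr)
    assume "x \<notin> ?C"
    then have x: "x \<in> ?I"
      using that by blast
    then have "M <#> K \<subseteq> N x <#> K"
      by (intro mono_set_mult M(2) order_refl)
    then show False
      using N(2)[OF x] that(3) subsetD by metis
  qed
  have nM: "M \<lhd> G"
    using M(1) by (simp add: virtual_normal_overgroups_def)
  have "M \<inter> ?C \<lhd> G"
  proof (rule normal_if_generators_normalize[OF _ S(2,3)])
    show "subgroup (M \<inter> ?C) G"
      using subgroups_Inter_pair[OF normal_imp_subgroup[OF nM] subgroup_virtual_closure[OF sK]] .
    fix s l assume s: "s \<in> ?T" and l: "l \<in> M \<inter> ?C"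
    have sc: "s \<in> carrier G"
      using s T(2) by (rule rev_subsetD)
    have "s \<otimes> l \<otimes> inv s \<in> ?C"
      using conjugate_in_virtual_closure[OF H(1) sK sc M(1) R(2)[OF s] R(3)[OF s] sep[OF s]] l
      by blast
    then show "s \<otimes> l \<otimes> inv s \<in> M \<inter> ?C"
      using normal.inv_op_closed2[OF nM sc] l by blast
  qed
  moreover have "infinite (M \<inter> ?C)"
  proof -
    obtain A where A: "finite_index_subgroup G A H" "A \<subseteq> M"
      using M(1) by (auto simp: virtual_normal_overgroups_def)
    \<comment> \<open>\<open>A \<inter> K\<close> has finite index in the infinite group
      \<open>H\<close>, so it is infinite.\<close>
    have "A \<inter> K \<subseteq> M \<inter> ?C"
      using A(2) subset_virtual_closure[OF sK] by blast
    then show ?thesis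
      using finite_index_infinite[OF H(1) finite_index_Int[OF H(1) A(1) K] H(2)] infinite_super
      by blast
  qed
  ultimately show thesis
    using that by blast
qed

end

theorem corollary19:
  fixes G :: "('a, 'b) monoid_scheme" and H :: "'a set"
  assumes "group G"
    and "finitely_generated G"
    and "\<And>N. N \<lhd> G \<Longrightarrow> infinite N \<Longrightarrow> centralizer G N = {\<one>\<^bsub>G\<^esub>}"
    and "subgroup H G"
    and "infinite H"
    and "commensurated G H"
    and "relatively_residually_finite G H"
  shows "FC_centralizer G H = {\<one>\<^bsub>G\<^esub>}"
proof -
  interpret group G
    by fact
  have "f = \<one>\<^bsub>G\<^esub>" if f: "f \<in> FC_centralizer G H" for f
  proof -
    obtain K where K: "finite_index_subgroup G K H" "f \<in> centralizer G K"
      using f by (auto simp: FC_centralizer_def)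
    obtain L where L: "L \<lhd> G" "infinite L" "L \<subseteq> virtual_closure G H K"
      using infinite_normal_in_virtual_closure[OF assms(2,4,5,6) K(1)] by blast
    have "f \<in> centralizer G (virtual_closure G H K)"
      using centralizes_virtual_closure[OF assms(7) _ K(2)] finite_index_subgroupD(1)[OF assms(4) K(1)]
      by blast
    \<comment> \<open>Centralizers reverse inclusions; the hypothesis on infinite normal subgroups
      then applies to \<open>L\<close>.\<close>
    then have "f \<in> centralizer G L"
      using L(3) by (auto simp: centralizer_def)
    then show ?thesis
      using assms(3)[OF L(1,2)] by simp
  qed
  moreover have "\<one>\<^bsub>G\<^esub> \<in> FC_centralizer G H"
    using finite_index_refl[OF assms(4)] subgroup.mem_carrier[OF assms(4)]
    by (auto simp: FC_centralizer_def centralizer_def)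
  ultimately show ?thesis
    by blast
qed

end
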